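(* Let $S$ be a modal Kleene algebra and $a\in S$. Then $a$ is Noetherian if and only if $a$ is pre-Löbian, i.e. if and only if $|a\rangle \le |a^+\rangle\,\max_a$ (pointwise: $|a\rangle p\le |a^+\rangle(p-|a\rangle p)$ for all $p\in\mathrm{test}(S)$).
   Context: An idempotent semiring is a structure $(S,+,\cdot,0,1)$ such that $(S,+,0)$ is a commutative monoid with $a+a=a$, $(S,\cdot,1)$ is a monoid, multiplication distributes over addition from both sides, and $0a=a0=0$. Its natural order is $a\le b\iff a+b=b$. A test is an element $p\le 1$ for which some $q$ satisfies $p+q=1$ and $pq=0=qp$; this $q$ is unique and written $\neg p$. The set $\mathrm{test}(S)$ of tests is a Boolean algebra (join $+$, meet $\cdot$, bottom $0$, top $1$, complement $\neg$); write $p-q=p\cdot\neg q$. $S$ is a modal semiring if for each $a\in S$ there are maps $|a\rangle,\langle a|:\mathrm{test}(S)\to\mathrm{test}(S)$ such that for all $a,b\in S$ and tests $p,q$: $|a\rangle p\le q\iff \neg q\,a\,p\le 0$; $\langle a|p\le q\iff p\,a\,\neg q\le 0$; $|ab\rangle p=|a\rangle(|b\rangle p)$; $\langle ab|p=\langle b|(\langle a|p)$. Maps $\mathrm{test}(S)\to\mathrm{test}(S)$ are ordered and combined pointwise; juxtaposition of maps denotes composition. A Kleene algebra is an idempotent semiring with an operation ${}^*$ such that $1+aa^*\le a^*$, $b+ac\le c\Rightarrow a^*b\le c$, $1+a^*a\le a^*$, and $b+ca\le c\Rightarrow ba^*\le c$; $a^+=aa^*$. A modal Kleene algebra is a Kleene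 algebra that is a modal semiring. For $a\in S$, $\max_a$ is the map $p\mapsto p-|a\rangle p$. The element $a$ is Noetherian if for all tests $p$, $\max_a p\le 0$ implies $p\le 0$. *)

theory Defs
  imports Main
begin

text \<open>The library class \<open>semiring_1\<close> is not used as a basis, since it excludes the trivial
  semiring by requiring \<open>0 \<noteq> 1\<close>.\<close>

class idempotent_semiring = semiring_0 + monoid_mult + ord +
  assumes add_idem: "a + a = a"
    and natural_order: "a \<le> b \<longleftrightarrow> a + b = b"
    and natural_strict_order: "a < b \<longleftrightarrow> a \<le> b \<and> a \<noteq> b"
begin

subclass order
proof
  fix x y z :: 'a
  show "x < y \<longleftrightarrow> x \<le> y \<and> \<not> y \<le> x"
    by (metis add.commute natural_order natural_strict_order)
  show "x \<le> x"
    by (simp add: natural_order add_idem)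
  show "x \<le> z" if "x \<le> y" "y \<le> z"
    using that by (metis add.assoc natural_order)
  show "x = y" if "x \<le> y" "y \<le> x"
    using that by (metis add.commute natural_order)
qed

definition is_compl :: "'a \<Rightarrow> 'a \<Rightarrow> bool" where
  "is_compl p q \<longleftrightarrow> p + q = 1 \<and> p * q = 0 \<and> q * p = 0"

definition is_test :: "'a \<Rightarrow> bool" where
  "is_test p \<longleftrightarrow> p \<le> 1 \<and> (\<exists>q. is_compl p q)"

text \<open>Meaningful on tests only.\<close>

definition tcompl :: "'a \<Rightarrow> 'a" where
  "tcompl p = (THE q. is_compl p q)"

definition tminus :: "'a \<Rightarrow> 'a \<Rightarrow> 'a" where
  "tminus p q = p * tcompl q"

lemma is_compl_unique:
  assumes "is_compl p q" "is_compl p r"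
  shows "q = r"
proof -
  have "q = q * (p + r)" "r = (p + q) * r"
    using assms by (simp_all add: is_compl_def)
  then show ?thesis
    using assms by (simp add: is_compl_def distrib_left distrib_right)
qed

lemma is_compl_tcompl: "is_test p \<Longrightarrow> is_compl p (tcompl p)"
  unfolding is_test_def tcompl_def by (metis is_compl_unique theI)

definition test_map_le :: "('a \<Rightarrow> 'a) \<Rightarrow> ('a \<Rightarrow> 'a) \<Rightarrow> bool" where
  "test_map_le f g \<longleftrightarrow> (\<forall>p. is_test p \<longrightarrow> f p \<le> g p)"

end

text \<open>The operators \<open>fdia a\<close> and \<open>bdia a\<close> render the maps \<open>|a\<rangle>\<close> and \<open>\<langle>a|\<close> on tests; their
  values on elements that are not tests are unconstrained and never used.\<close>

class modal_semiring = idempotent_semiring +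
  fixes fdia :: "'a \<Rightarrow> 'a \<Rightarrow> 'a"
    and bdia :: "'a \<Rightarrow> 'a \<Rightarrow> 'a"
  assumes fdia_test: "is_test p \<Longrightarrow> is_test (fdia a p)"
    and bdia_test: "is_test p \<Longrightarrow> is_test (bdia a p)"
    and fdia_demod: "is_test p \<Longrightarrow> is_test q \<Longrightarrow> fdia a p \<le> q \<longleftrightarrow> tcompl q * a * p \<le> 0"
    and bdia_demod: "is_test p \<Longrightarrow> is_test q \<Longrightarrow> bdia a p \<le> q \<longleftrightarrow> p * a * tcompl q \<le> 0"
    and fdia_mult: "is_test p \<Longrightarrow> fdia (a * b) p = fdia a (fdia b p)"
    and bdia_mult: "is_test p \<Longrightarrow> bdia (a * b) p = bdia b (bdia a p)"
begin

definition max_test :: "'a \<Rightarrow> 'a \<Rightarrow> 'a" where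
  "max_test a p = tminus p (fdia a p)"

definition noetherian :: "'a \<Rightarrow> bool" where
  "noetherian a \<longleftrightarrow> (\<forall>p. is_test p \<longrightarrow> max_test a p \<le> 0 \<longrightarrow> p \<le> 0)"

end

class kleene_algebra = idempotent_semiring +
  fixes star :: "'a \<Rightarrow> 'a"
  assumes star_unfold_left: "1 + a * star a \<le> star a"
    and star_induct_left: "b + a * c \<le> c \<Longrightarrow> star a * b \<le> c"
    and star_unfold_right: "1 + star a * a \<le> star a"
    and star_induct_right: "b + c * a \<le> c \<Longrightarrow> b * star a \<le> c"
begin

definition kplus :: "'a \<Rightarrow> 'a" where
  "kplus a = a * star a"

end

class modal_kleene_algebra = kleene_algebra + modal_semiring
begin

definition pre_loebian :: "'a \<Rightarrow> bool" where
  "pre_loebian a \<longleftrightarrow> test_map_le (fdia a) (fdia (kplus a) \<circ> max_test a)"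

end

end

theory Submission
  imports Defs
begin

text \<open>Put \<open>m = max\<^sub>a p\<close>, \<open>r = |a\<^sup>*\<rangle> m\<close> and \<open>q = p - r\<close>. Since \<open>p \<le> m + |a\<rangle> p\<close>, \<open>p \<le> q + r\<close>, \<open>m \<le> r\<close>
  and \<open>|a\<rangle> r \<le> r\<close>, one gets \<open>p \<le> |a\<rangle> q + r\<close>, that is, \<open>q \<le> |a\<rangle> q\<close>. If \<open>a\<close> is Noetherian, then
  \<open>q = 0\<close>, so \<open>p \<le> r\<close> and \<open>|a\<rangle> p \<le> |a\<rangle> r = |a\<^sup>+\<rangle> m\<close>. Conversely, if \<open>max\<^sub>a p = 0\<close>, then \<open>p \<le> |a\<rangle> p\<close>, and
  the pre-Loebian inequality gives \<open>|a\<rangle> p \<le> |a\<^sup>+\<rangle> 0 = 0\<close>.\<close>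

context idempotent_semiring
begin

lemma le_zero_iff: "x \<le> 0 \<longleftrightarrow> x = 0"
  by (simp add: natural_order)

lemma add_upper1: "x \<le> x + y"
  by (metis add.assoc add_idem natural_order)

lemma add_upper2: "y \<le> x + y"
  by (metis add.commute add_upper1)

lemma add_least: "x \<le> z \<Longrightarrow> y \<le> z \<Longrightarrow> x + y \<le> z"
  by (simp add: natural_order add.assoc)

lemma mult_mono_left: "x \<le> y \<Longrightarrow> z * x \<le> z * y"
  by (metis natural_order distrib_left)

lemma mult_mono_right: "x \<le> y \<Longrightarrow> x * z \<le> y * z"
  by (metis natural_order distrib_right)

lemma is_compl_sym: "is_compl p q \<Longrightarrow> is_compl q p"
  by (simp add: is_compl_def add.commute)

lemma is_compl_le_one: "is_compl p q \<Longrightarrow> p \<le> 1"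
  by (metis is_compl_def add_upper1)

lemma is_compl_is_test: "is_compl p q \<Longrightarrow> is_test p"
  using is_test_def is_compl_le_one by blast

lemma is_test_tcompl: "is_test p \<Longrightarrow> is_test (tcompl p)"
  using is_compl_is_test is_compl_sym is_compl_tcompl by blast

lemma mult_test_le_left: "is_test p \<Longrightarrow> x * p \<le> x"
  using mult_mono_left[of p 1 x] by (simp add: is_test_def)

lemma mult_test_le_right: "is_test p \<Longrightarrow> p * x \<le> x"
  using mult_mono_right[of p 1 x] by (simp add: is_test_def)

text \<open>De Morgan, with \<open>p' + p * q'\<close> in place of \<open>p' + q'\<close>: the sum
  telescopes through \<open>p * q + p * q' = p\<close>, and no commutation of tests is
  invoked.\<close>

lemma is_compl_mult:
  assumes p: "is_compl p p'" and q: "is_compl q q'"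
  shows "is_compl (p * q) (p' + p * q')"
proof -
  have tests: "is_test p" "is_test q"
    using assms is_compl_is_test by blast+
  have "p * q + (p' + p * q') = p * (q + q') + p'"
    by (simp add: distrib_left ac_simps)
  then have sum: "p * q + (p' + p * q') = 1"
    using assms by (simp add: is_compl_def)
  have "p * q * p' = 0"
    using mult_mono_right[OF mult_test_le_left[OF tests(2), of p], of p'] p
    by (simp add: is_compl_def le_zero_iff)
  moreover have "p * q * (p * q') = 0"
    using mult_mono_left[OF mult_test_le_right[OF tests(1), of q'], of q] q
    by (simp add: is_compl_def le_zero_iff mult.assoc)
  moreover have "p * q' * (p * q) = 0"
    using mult_mono_left[OF mult_test_le_right[OF tests(1), of q], of q'] q
    by (simp add: is_compl_def le_zero_iff mult.assoc)
  moreover have "p' * (p * q) = 0"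
    using p by (simp add: is_compl_def flip: mult.assoc)
  ultimately show ?thesis
    using sum by (simp add: is_compl_def distrib_left distrib_right)
qed

lemma is_test_mult: "is_test p \<Longrightarrow> is_test q \<Longrightarrow> is_test (p * q)"
  using is_compl_mult is_compl_is_test is_compl_tcompl by blast

text \<open>The sum is rewritten as \<open>p + ?p' * q\<close>, which is exactly the complement that
  \<open>is_compl_mult\<close> gives for \<open>?p' * ?q'\<close>.\<close>

lemma is_test_add:
  assumes "is_test p" "is_test q"
  shows "is_test (p + q)"
proof -
  let ?p' = "tcompl p" and ?q' = "tcompl q"
  have p: "is_compl p ?p'" and q: "is_compl q ?q'"
    using assms is_compl_tcompl by blast+
  have "p + q = p + (p + ?p') * q"
    using p by (simp add: is_compl_def)
  also have "\<dots> = (p + p * q) + ?p' * q"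
    by (simp add: distrib_right add.assoc)
  also have "p + p * q = p"
    using mult_test_le_left[OF assms(2), of p] by (simp add: natural_order add.commute)
  finally have "p + q = p + ?p' * q" .
  then show ?thesis
    using is_compl_mult[OF is_compl_sym[OF p] is_compl_sym[OF q]] is_compl_is_test is_compl_sym
    by metis
qed

lemma is_test_zero: "is_test 0"
  using is_compl_is_test[of 0 1] by (simp add: is_compl_def)

lemma is_test_tminus: "is_test p \<Longrightarrow> is_test q \<Longrightarrow> is_test (tminus p q)"
  by (simp add: tminus_def is_test_mult is_test_tcompl)

text \<open>Residuation: one direction splits \<open>p\<close> along \<open>q\<close> and
  \<open>tcompl q\<close>, the other multiplies by \<open>tcompl q\<close> on the right, which kills
  \<open>q\<close>.\<close>

lemma tminus_le_iff:
  assumes "is_test p" "is_test q"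
  shows "tminus p q \<le> s \<longleftrightarrow> p \<le> s + q"
proof
  have q: "is_compl q (tcompl q)"
    using assms is_compl_tcompl by blast
  have split: "p * tcompl q + p * q = p"
    using q by (metis is_compl_def add.commute distrib_left mult_1_right)
  show "p \<le> s + q" if "tminus p q \<le> s"
  proof -
    have "p * tcompl q \<le> s + q"
      using that add_upper1 order_trans unfolding tminus_def by blast
    moreover have "p * q \<le> s + q"
      using mult_test_le_right[OF assms(1)] add_upper2 order_trans by blast
    ultimately show ?thesis
      using add_least split by metis
  qed
  show "tminus p q \<le> s" if "p \<le> s + q"
  proof -
    have "p * tcompl q \<le> s * tcompl q"
      using mult_mono_right[OF that, of "tcompl q"] q by (simp add: distrib_right is_compl_def)
    then show ?thesis
      using mult_test_le_left[OF is_test_tcompl[OF assms(2)], of s] order_trans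
      unfolding tminus_def by blast
  qed
qed

end

context modal_semiring
begin

text \<open>Demodalisation at the test \<open>fdia b q\<close> itself turns the claim into
  monotonicity of multiplication.\<close>

lemma fdia_mono:
  assumes "is_test p" "is_test q" "a \<le> b" "p \<le> q"
  shows "fdia a p \<le> fdia b q"
proof -
  let ?t = "fdia b q"
  have t: "is_test ?t"
    using assms fdia_test by blast
  have "tcompl ?t * a * p \<le> tcompl ?t * b * p"
    using assms(3) by (intro mult_mono_right mult_mono_left)
  also have "\<dots> \<le> tcompl ?t * b * q"
    using assms(4) by (rule mult_mono_left)
  also have "\<dots> \<le> 0"
    using fdia_demod[OF assms(2) t] by blast
  finally show ?thesis
    using fdia_demod[OF assms(1) t] by blast
qed

lemma fdia_zero: "fdia a 0 = 0"
  using fdia_demod[OF is_test_zero is_test_zero, of a] by (simp add: le_zero_iff)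

lemma le_fdia_one:
  assumes "is_test p"
  shows "p \<le> fdia 1 p"
proof -
  let ?t = "fdia 1 p"
  have t: "is_test ?t"
    using assms fdia_test by blast
  \<comment> \<open>Demodalisation at \<open>?t\<close> is applied to the trivial inequality
    \<open>?t \<le> ?t\<close>; hence \<open>p\<close> lies entirely inside
    \<open>?t\<close>.\<close>
  have "tcompl ?t * p = 0"
    using fdia_demod[OF assms t, of 1] by (simp add: le_zero_iff)
  moreover have "p = ?t * p + tcompl ?t * p"
    using is_compl_tcompl[OF t] by (metis is_compl_def distrib_right mult_1_left)
  ultimately have "p = ?t * p"
    by simp
  then show ?thesis
    using mult_test_le_left[OF assms] by metis
qed

text \<open>Takes the place of additivity of the diamond: \<open>tcompl t * a\<close> distributes
  over \<open>q + r\<close> and annihilates both summands.\<close>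

lemma fdia_le_of_cover:
  assumes "is_test p" "is_test q" "is_test r" "is_test t"
    and "p \<le> q + r" "fdia a q \<le> t" "fdia a r \<le> t"
  shows "fdia a p \<le> t"
proof -
  have "tcompl t * a * p \<le> tcompl t * a * q + tcompl t * a * r"
    using mult_mono_left[OF assms(5), of "tcompl t * a"] by (simp add: distrib_left)
  then show ?thesis
    using assms fdia_demod by (simp add: le_zero_iff)
qed

lemma is_test_max_test: "is_test p \<Longrightarrow> is_test (max_test a p)"
  by (simp add: max_test_def is_test_tminus fdia_test)

text \<open>At \<open>s = 0\<close> the right side is \<open>p \<le> fdia a p\<close>, so Noetherian
  means that 0 is the only such test.\<close>

lemma max_test_le_iff: "is_test p \<Longrightarrow> max_test a p \<le> s \<longleftrightarrow> p \<le> s + fdia a p"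
  by (simp add: max_test_def tminus_le_iff fdia_test)

end

context modal_kleene_algebra
begin

lemma le_fdia_star:
  assumes "is_test p"
  shows "p \<le> fdia (star a) p"
proof -
  have "1 \<le> star a"
    using star_unfold_left add_upper1 order_trans by blast
  then show ?thesis
    using le_fdia_one[OF assms] fdia_mono[OF assms assms _ order_refl] order_trans by blast
qed

lemma fdia_fdia_star_le:
  assumes "is_test p"
  shows "fdia a (fdia (star a) p) \<le> fdia (star a) p"
proof -
  have "a * star a \<le> star a"
    using star_unfold_left add_upper2 order_trans by blast
  then show ?thesis
    using fdia_mono[OF assms assms _ order_refl] fdia_mult[OF assms] by metis
qed

text \<open>Stated with \<open>star a\<close> so that one application of \<open>fdia a\<close> to
  both sides yields the pre-Loebian inequality, since \<open>kplus a = a * star a\<close>.\<close>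

lemma noetherian_le_fdia_star_max_test:
  assumes "noetherian a" and p: "is_test p"
  shows "p \<le> fdia (star a) (max_test a p)"
proof -
  define m where "m = max_test a p"
  define r where "r = fdia (star a) m"
  define q where "q = tminus p r"
  have m: "is_test m" and r: "is_test r" and q: "is_test q"
    by (simp_all add: m_def r_def q_def p is_test_max_test fdia_test is_test_tminus)
  let ?t = "fdia a q + r"
  have t: "is_test ?t"
    using q r fdia_test is_test_add by blast
  have "p \<le> q + r"
    using tminus_le_iff[OF p r, of q] by (simp add: q_def)
  moreover have "fdia a r \<le> ?t"
    using fdia_fdia_star_le[OF m] add_upper2 order_trans unfolding r_def by blast
  ultimately have "fdia a p \<le> ?t"
    using fdia_le_of_cover[OF p q r t] add_upper1 by blast
  moreover have "m \<le> ?t"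
    using le_fdia_star[OF m] add_upper2 order_trans unfolding r_def by blast
  moreover have "p \<le> m + fdia a p"
    using max_test_le_iff[OF p, of a m] by (simp add: m_def)
  ultimately have "p \<le> ?t"
    using add_least order_trans by blast
  \<comment> \<open>Residuation moves the summand \<open>r\<close> of \<open>?t\<close> to the left,
    where it turns \<open>p\<close> into \<open>q\<close>.\<close>
  then have "q \<le> fdia a q"
    using tminus_le_iff[OF p r] by (simp add: q_def)
  then have "max_test a q \<le> 0"
    using max_test_le_iff[OF q, of a 0] by simp
  then have "q \<le> 0"
    using assms(1) q by (simp add: noetherian_def)
  then show ?thesis
    using tminus_le_iff[OF p r, of 0] by (simp add: q_def r_def m_def)
qed

lemma noetherian_imp_pre_loebian:
  assumes "noetherian a"
  shows "pre_loebian a"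
  unfolding pre_loebian_def test_map_le_def
proof (intro allI impI)
  fix p assume p: "is_test p"
  have m: "is_test (max_test a p)"
    using p by (rule is_test_max_test)
  have "fdia a p \<le> fdia a (fdia (star a) (max_test a p))"
    using fdia_mono[OF p fdia_test[OF m] order_refl]
      noetherian_le_fdia_star_max_test[OF assms p] by blast
  then show "fdia a p \<le> (fdia (kplus a) \<circ> max_test a) p"
    by (simp add: kplus_def fdia_mult[OF m])
qed

lemma pre_loebian_imp_noetherian:
  assumes "pre_loebian a"
  shows "noetherian a"
  unfolding noetherian_def
proof (intro allI impI)
  fix p assume p: "is_test p" and max: "max_test a p \<le> 0"
  have "fdia a p \<le> fdia (kplus a) (max_test a p)"
    using assms p by (simp add: pre_loebian_def test_map_le_def)
  then have "fdia a p \<le> 0"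
    using max by (simp add: le_zero_iff fdia_zero)
  moreover have "p \<le> fdia a p"
    using max max_test_le_iff[OF p, of a 0] by simp
  ultimately show "p \<le> 0"
    by (rule order_trans[rotated])
qed

end

theorem theorem5p5:
  fixes a :: "'a::modal_kleene_algebra"
  shows "noetherian a \<longleftrightarrow> pre_loebian a"
  using noetherian_imp_pre_loebian pre_loebian_imp_noetherian by blast

end
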